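(* Let $(\mathcal{R},\partial,\int)$ be an integro-differential ring with constants $\mathcal{C}$ and induced evaluation $\mathrm{E}$. For all $n\ge1$ let $x_n:=\int^n1\in\mathcal{R}$ and let $x_0:=1$. Then $1,x_1,x_2,\ldots$ commute with all elements of $\mathcal{C}$ and are $\mathcal{C}$-linearly independent. The $\mathcal{C}$-module $$\mathcal{P}:=\mathrm{span}_{\mathcal{C}}\{1,x_1,x_2,\ldots\}$$ is an integro-differential subring of $\mathcal{R}$. If $\mathbb{Q}\subseteq\mathcal{R}$, then $\mathcal{P}=\mathcal{C}[x_1]$. Moreover, $\mathrm{E}$ is multiplicative on $\mathcal{P}$ if and only if $\mathrm{E}(x_mx_n)=0$ for all $m,n\ge1$. If $\mathrm{E}$ is multiplicative on $\mathcal{P}$, then $x_mx_n=\binom{m+n}{m}x_{m+n}$ for all $m,n\in\mathbb{N}$ and, if in addition $\mathbb{Q}\subseteq\mathcal{R}$, $x_n=\frac{1}{n!}x_1^n$ for all $n\in\mathbb{N}$.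
   Context: Rings are unital, nonzero, not necessarily commutative, of arbitrary characteristic; $\mathbb{N}$ contains $0$. A derivation on a ring $\mathcal{R}$ is an additive map $\partial$ with $\partial(fg)=(\partial f)g+f\,\partial g$; $\mathcal{C}=\{f\in\mathcal{R}:\partial f=0\}$ is the ring of constants. "$\mathcal{C}$-linear" means homomorphism of $\mathcal{C}$-bimodules. An integro-differential ring $(\mathcal{R},\partial,\int)$ is a differential ring together with a $\mathcal{C}$-linear map $\int\colon\mathcal{R}\to\mathcal{R}$ satisfying $\partial\int f=f$ for all $f\in\mathcal{R}$. Its induced evaluation is $\mathrm{E}f:=f-\int\partial f$ (it takes values in $\mathcal{C}$). An integro-differential subring is a subring closed under $\partial$ and $\int$. $\mathrm{E}$ is multiplicative on $\mathcal{P}$ if $\mathrm{E}(fg)=(\mathrm{E}f)(\mathrm{E}g)$ for all $f,g\in\mathcal{P}$. $\mathcal{C}[x_1]$ denotes the subring of $\mathcal{R}$ generated by $\mathcal{C}$ and $x_1$. *)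

theory Defs
  imports Complex_Main
begin

text \<open>The ring is the type \<open>'a\<close> of class \<^class>\<open>ring_1\<close>: unital, nonzero, not necessarily
  commutative, of arbitrary characteristic.\<close>

locale differential_ring = additive D for D :: "'a::ring_1 \<Rightarrow> 'a" +
  assumes leibniz: "D (f * g) = D f * g + f * D g"

definition constants :: "('a::ring_1 \<Rightarrow> 'a) \<Rightarrow> 'a set" where
  "constants D = {f. D f = 0}"

text \<open>Linearity over a set \<open>C\<close> of scalars is two-sided: homomorphism of \<open>C\<close>-bimodules.\<close>

definition bimodule_hom :: "'a::ring_1 set \<Rightarrow> ('a \<Rightarrow> 'a) \<Rightarrow> bool" where
  "bimodule_hom C F \<longleftrightarrow> additive F \<and>
     (\<forall>c\<in>C. \<forall>f. F (c * f) = c * F f \<and> F (f * c) = F f * c)"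

locale integro_differential_ring = differential_ring D
  for D :: "'a::ring_1 \<Rightarrow> 'a" +
  fixes J :: "'a \<Rightarrow> 'a"
  assumes integral_linear: "bimodule_hom (constants D) J"
    and deriv_integral: "D (J f) = f"

definition evaluation :: "('a::ring_1 \<Rightarrow> 'a) \<Rightarrow> ('a \<Rightarrow> 'a) \<Rightarrow> 'a \<Rightarrow> 'a" where
  "evaluation D J f = f - J (D f)"

definition multiplicative_on :: "'a::ring_1 set \<Rightarrow> ('a \<Rightarrow> 'a) \<Rightarrow> bool" where
  "multiplicative_on S E \<longleftrightarrow> (\<forall>f\<in>S. \<forall>g\<in>S. E (f * g) = E f * E g)"

definition unital_subring :: "'a::ring_1 set \<Rightarrow> bool" where
  "unital_subring S \<longleftrightarrow> 1 \<in> S \<and> (\<forall>f\<in>S. \<forall>g\<in>S. f - g \<in> S \<and> f * g \<in> S)"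

definition integro_differential_subring ::
    "('a::ring_1 \<Rightarrow> 'a) \<Rightarrow> ('a \<Rightarrow> 'a) \<Rightarrow> 'a set \<Rightarrow> bool" where
  "integro_differential_subring D J S \<longleftrightarrow>
     unital_subring S \<and> (\<forall>f\<in>S. D f \<in> S \<and> J f \<in> S)"

definition subring_generated :: "'a::ring_1 set \<Rightarrow> 'a set" where
  "subring_generated X = \<Inter>{S. unital_subring S \<and> X \<subseteq> S}"

text \<open>Independence and span of a family \<open>v\<close> over a set \<open>C\<close> of scalars, with coefficients on the
  left. If the members of \<open>v\<close> commute with \<open>C\<close>, the left, right and two-sided notions coincide.\<close>

definition family_independent :: "'a::ring_1 set \<Rightarrow> ('i \<Rightarrow> 'a) \<Rightarrow> bool" where
  "family_independent C v \<longleftrightarrow>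
     (\<forall>A c. finite A \<and> (\<forall>i\<in>A. c i \<in> C) \<and> (\<Sum>i\<in>A. c i * v i) = 0 \<longrightarrow> (\<forall>i\<in>A. c i = 0))"

definition family_span :: "'a::ring_1 set \<Rightarrow> ('i \<Rightarrow> 'a) \<Rightarrow> 'a set" where
  "family_span C v = {\<Sum>i\<in>A. c i * v i | A c. finite A \<and> (\<forall>i\<in>A. c i \<in> C)}"

definition iterated_integral :: "('a::ring_1 \<Rightarrow> 'a) \<Rightarrow> nat \<Rightarrow> 'a" where
  "iterated_integral J n = (J ^^ n) 1"

definition integral_polynomials :: "('a::ring_1 \<Rightarrow> 'a) \<Rightarrow> ('a \<Rightarrow> 'a) \<Rightarrow> 'a set" where
  "integral_polynomials D J = family_span (constants D) (iterated_integral J)"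

text \<open>The ring contains the rationals iff such an \<open>h\<close> exists; \<open>h\<close> is then unique.\<close>

definition rat_embedding :: "(rat \<Rightarrow> 'a::ring_1) \<Rightarrow> bool" where
  "rat_embedding h \<longleftrightarrow> inj h \<and> h 1 = 1 \<and>
     (\<forall>p q. h (p + q) = h p + h q \<and> h (p * q) = h p * h q)"

end

theory Submission
  imports Defs
begin

text \<open>The module \<open>P\<close> is the set of elements annihilated by some power of \<open>D\<close>: if
  \<open>D\<^sup>N\<^sup>+\<^sup>1 f = 0\<close>, then \<open>c = D\<^sup>N f\<close> is a constant and \<open>D\<^sup>N\<close> kills \<open>f - c x\<^sub>N\<close>. This description makes
  the closure properties immediate, and it holds for every sequence \<open>y\<close> with \<open>y\<^sub>0 = 1\<close> and
  \<open>D y\<^sub>n\<^sub>+\<^sub>1 = y\<^sub>n\<close> in place of \<open>x\<close>. Over the rationals \<open>y\<^sub>n = x\<^sub>1\<^sup>n / n!\<close> is such a sequence, whence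
  \<open>P = C[x\<^sub>1]\<close>. For the product formula, \<open>f = J (D f)\<close> whenever \<open>E f = 0\<close>, so the formula for
  \<open>x\<^sub>m x\<^sub>n\<close> follows by integrating its derivative.\<close>

section \<open>Spans, generated subrings and embeddings of the rationals\<close>

lemma family_span_induct [consumes 1, case_names zero add scale]:
  assumes "f \<in> family_span C v"
    and "Q 0" and "\<And>f g. Q f \<Longrightarrow> Q g \<Longrightarrow> Q (f + g)"
    and "\<And>c i. c \<in> C \<Longrightarrow> Q (c * v i)"
  shows "Q f"
proof -
  obtain A c where f: "f = (\<Sum>i\<in>A. c i * v i)" and "finite A" "\<forall>i\<in>A. c i \<in> C"
    using assms(1) by (auto simp: family_span_def)
  from this(2,3) have "Q (\<Sum>i\<in>A. c i * v i)"
    by (induction A rule: finite_induct) (auto intro: assms(2-4))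
  then show ?thesis by (simp add: f)
qed

lemma family_spanI:
  assumes "finite A" "\<And>i. i \<in> A \<Longrightarrow> c i \<in> C"
  shows "(\<Sum>i\<in>A. c i * v i) \<in> family_span C v"
  using assms unfolding family_span_def by blast

lemma unital_subringD:
  assumes "unital_subring S"
  shows "1 \<in> S" "0 \<in> S" "\<And>f g. f \<in> S \<Longrightarrow> g \<in> S \<Longrightarrow> f + g \<in> S"
    "\<And>f g. f \<in> S \<Longrightarrow> g \<in> S \<Longrightarrow> f * g \<in> S" "\<And>f n. f \<in> S \<Longrightarrow> f ^ n \<in> S"
proof -
  show 1: "1 \<in> S" and mult: "\<And>f g. f \<in> S \<Longrightarrow> g \<in> S \<Longrightarrow> f * g \<in> S"
    using assms by (auto simp: unital_subring_def)
  have diff: "\<And>f g. f \<in> S \<Longrightarrow> g \<in> S \<Longrightarrow> f - g \<in> S"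
    using assms by (auto simp: unital_subring_def)
  show 0: "0 \<in> S" using diff[OF 1 1] by simp
  show "f + g \<in> S" if "f \<in> S" "g \<in> S" for f g
    using diff[OF that(1) diff[OF 0 that(2)]] by simp
  show "f ^ n \<in> S" if "f \<in> S" for f n
    by (induction n) (auto intro: 1 mult that)
qed

lemma unital_subring_generated: "unital_subring (subring_generated X)"
  unfolding subring_generated_def unital_subring_def by blast

lemma subring_generated_superset: "X \<subseteq> subring_generated X"
  unfolding subring_generated_def by blast

lemma subring_generated_least:
  "unital_subring S \<Longrightarrow> X \<subseteq> S \<Longrightarrow> subring_generated X \<subseteq> S"
  unfolding subring_generated_def by blast

lemma rat_embedding_of_nat:
  assumes "rat_embedding h"
  shows "h (of_nat n) = of_nat n"
proof -
  have add: "\<And>p q. h (p + q) = h p + h q" and "h 1 = 1"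
    using assms by (auto simp: rat_embedding_def)
  moreover have "h 0 = 0" using add[of 0 0] by simp
  ultimately show ?thesis by (induction n) simp_all
qed

lemma rat_embedding_mult: "rat_embedding h \<Longrightarrow> h (p * q) = h p * h q"
  by (simp add: rat_embedding_def)

lemma rat_embedding_inverse:
  assumes "rat_embedding h" "n > 0"
  shows "h (1 / of_nat n) * of_nat n = 1"
proof -
  have "h (1 / of_nat n) * of_nat n = h (1 / of_nat n * of_nat n)"
    by (simp only: rat_embedding_mult[OF assms(1)] rat_embedding_of_nat[OF assms(1)])
  also have "\<dots> = 1" using assms by (simp add: rat_embedding_def)
  finally show ?thesis .
qed

section \<open>Derivations and the elements annihilated by their powers\<close>

context differential_ring
begin

lemma deriv_one [simp]: "D 1 = 0"
  using leibniz[of 1 1] by simp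

lemma deriv_of_nat [simp]: "D (of_nat n) = 0"
  by (induction n) (simp_all add: zero add)

lemma of_nat_mem_constants: "of_nat n \<in> constants D"
  by (simp add: constants_def)

lemma deriv_constant: "c \<in> constants D \<Longrightarrow> D c = 0"
  by (simp add: constants_def)

lemma deriv_mult_constant: "c \<in> constants D \<Longrightarrow> D (c * f) = c * D f"
  by (simp add: constants_def leibniz)

text \<open>With \<open>q = h (1 / of_nat n)\<close>, differentiating
  \<open>q * of_nat n = 1\<close> leaves \<open>of_nat n * D q = 0\<close>, because
  \<open>of_nat n\<close> is a constant; multiplying by \<open>q\<close> cancels
  \<open>of_nat n\<close>.\<close>

lemma rat_embedding_mem_constants:
  assumes "rat_embedding h" "n > 0"
  shows "h (1 / of_nat n) \<in> constants D"
proof -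
  let ?q = "h (1 / of_nat n)"
  have q: "?q * of_nat n = 1" by (rule rat_embedding_inverse[OF assms])
  have "of_nat n * D ?q = D (?q * of_nat n)"
    by (simp add: leibniz mult_of_nat_commute)
  then have "?q * (of_nat n * D ?q) = 0" by (simp add: q)
  then have "D ?q = 0" by (simp add: q flip: mult.assoc)
  then show ?thesis by (simp add: constants_def)
qed

text \<open>The hypothesis lets every factor \<open>D f\<close> produced by the Leibniz rule move to
  the right of the powers of \<open>f\<close>, so the usual power rule survives without
  commutativity. It is later applied with \<open>D f = 1\<close>.\<close>

lemma deriv_power_commuting:
  assumes "f * D f = D f * f"
  shows "D (f ^ Suc n) = of_nat (Suc n) * (f ^ n * D f)"
proof (induction n)
  case (Suc n)
  have comm: "D f * f ^ k = f ^ k * D f" for k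
    using assms by (metis power_commuting_commutes)
  have "D (f ^ Suc (Suc n)) = D f * f ^ Suc n + f * D (f ^ Suc n)"
    by (simp only: power_Suc[of f "Suc n"] leibniz)
  also have "\<dots> = f ^ Suc n * D f + of_nat (Suc n) * (f * (f ^ n * D f))"
    by (simp only: Suc.IH comm mult.assoc[symmetric] mult_of_nat_commute[symmetric])
  finally show ?case by (simp add: algebra_simps)
qed simp

text \<open>Not the nilpotent elements of the ring, but the union of the kernels of all powers of
  \<open>D\<close>. Neither an integral nor a chosen sequence enters, so the spans of different
  sequences can be compared through this set.\<close>

definition nilpotents :: "'a set" where
  "nilpotents = {f. \<exists>n. (D ^^ n) f = 0}"

lemma deriv_iter_zero [simp]: "(D ^^ n) 0 = 0"
  by (induction n) (simp_all add: zero)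

lemma deriv_iter_diff: "(D ^^ n) (f - g) = (D ^^ n) f - (D ^^ n) g"
  by (induction n) (simp_all add: diff)

lemma deriv_iter_mult_constant:
  "c \<in> constants D \<Longrightarrow> (D ^^ n) (c * f) = c * (D ^^ n) f"
  by (induction n) (simp_all add: deriv_mult_constant)

lemma deriv_iter_mono: "(D ^^ m) f = 0 \<Longrightarrow> m \<le> n \<Longrightarrow> (D ^^ n) f = 0"
  by (metis comp_apply deriv_iter_zero funpow_add le_add_diff_inverse2)

text \<open>Passing between \<open>f\<close> and \<open>D f\<close> only shifts the annihilating
  power by one. The direction from \<open>D f\<close> to \<open>f\<close> gives closure under
  antiderivatives and drives the argument for products.\<close>

lemma deriv_mem_nilpotents_iff: "D f \<in> nilpotents \<longleftrightarrow> f \<in> nilpotents"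
proof
  assume "D f \<in> nilpotents"
  then obtain n where "(D ^^ Suc n) f = 0"
    by (auto simp: nilpotents_def funpow_swap1)
  then show "f \<in> nilpotents" unfolding nilpotents_def by blast
next
  assume "f \<in> nilpotents"
  then obtain n where "(D ^^ n) f = 0" by (auto simp: nilpotents_def)
  then have "(D ^^ n) (D f) = 0"
    by (simp add: zero flip: funpow_swap1)
  then show "D f \<in> nilpotents" unfolding nilpotents_def by blast
qed

lemma zero_mem_nilpotents: "0 \<in> nilpotents"
  unfolding nilpotents_def by simp

lemma constants_subset_nilpotents: "constants D \<subseteq> nilpotents"
  using deriv_mem_nilpotents_iff zero_mem_nilpotents by (fastforce simp: constants_def)

lemma diff_mem_nilpotents:
  assumes "f \<in> nilpotents" "g \<in> nilpotents"
  shows "f - g \<in> nilpotents"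
proof -
  obtain m n where "(D ^^ m) f = 0" "(D ^^ n) g = 0"
    using assms by (auto simp: nilpotents_def)
  then have "(D ^^ max m n) (f - g) = 0"
    by (simp add: deriv_iter_diff deriv_iter_mono[of m f "max m n"]
        deriv_iter_mono[of n g "max m n"])
  then show ?thesis unfolding nilpotents_def by blast
qed

lemma add_mem_nilpotents:
  assumes "f \<in> nilpotents" "g \<in> nilpotents"
  shows "f + g \<in> nilpotents"
  using diff_mem_nilpotents[OF assms(1) diff_mem_nilpotents[OF zero_mem_nilpotents assms(2)]]
  by simp

text \<open>In \<open>D (f * g) = D f * g + f * D g\<close> each term has a smaller sum of
  annihilating exponents, so by induction the derivative is in the set, and then so is
  \<open>f * g\<close>. This avoids the Leibniz formula for higher derivatives.\<close>

lemma mult_mem_nilpotents: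
  assumes "f \<in> nilpotents" "g \<in> nilpotents"
  shows "f * g \<in> nilpotents"
proof -
  obtain m n where "(D ^^ m) f = 0" "(D ^^ n) g = 0"
    using assms by (auto simp: nilpotents_def)
  then show ?thesis
  proof (induction "m + n" arbitrary: m n f g rule: less_induct)
    case less
    show ?case
    proof (cases "m = 0 \<or> n = 0")
      \<comment> \<open>The exponent 0 means that the factor itself is zero.\<close>
      case True
      then show ?thesis using less.prems zero_mem_nilpotents by auto
    next
      case False
      then obtain m' n' where mn: "m = Suc m'" "n = Suc n'"
        using not0_implies_Suc by blast
      have "D f * g \<in> nilpotents"
        using less.hyps[of m' n "D f" g] less.prems mn by (simp add: funpow_swap1)
      moreover have "f * D g \<in> nilpotents"
        using less.hyps[of m n' f "D g"] less.prems mn by (simp add: funpow_swap1)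
      ultimately have "D (f * g) \<in> nilpotents"
        by (simp add: leibniz add_mem_nilpotents)
      then show ?thesis by (simp add: deriv_mem_nilpotents_iff)
    qed
  qed
qed

lemma unital_subring_nilpotents: "unital_subring nilpotents"
  using constants_subset_nilpotents
  by (auto simp: unital_subring_def diff_mem_nilpotents mult_mem_nilpotents constants_def)

section \<open>Sequences of successive antiderivatives: span and independence\<close>

definition antiderivative_chain :: "(nat \<Rightarrow> 'a) \<Rightarrow> bool" where
  "antiderivative_chain y \<longleftrightarrow> y 0 = 1 \<and> (\<forall>n. D (y (Suc n)) = y n)"

lemma deriv_iter_chain: "antiderivative_chain y \<Longrightarrow> (D ^^ n) (y n) = 1"
  by (induction n) (simp_all add: antiderivative_chain_def funpow_swap1 del: funpow.simps(2)
      add: funpow_Suc_right)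

lemma chain_mem_nilpotents: "antiderivative_chain y \<Longrightarrow> y n \<in> nilpotents"
proof -
  assume y: "antiderivative_chain y"
  have "(D ^^ Suc n) (y n) = 0" using deriv_iter_chain[OF y, of n] by simp
  then show ?thesis unfolding nilpotents_def by blast
qed

lemma chain_expansion:
  assumes y: "antiderivative_chain y" and "(D ^^ n) f = 0"
  shows "\<exists>c. (\<forall>i. c i \<in> constants D) \<and> f = (\<Sum>i<n. c i * y i)"
  using assms(2)
proof (induction n arbitrary: f)
  case 0
  then show ?case by (auto intro!: exI[of _ "\<lambda>_. 0"] simp: constants_def zero)
next
  case (Suc n)
  let ?c = "(D ^^ n) f"
  have c: "?c \<in> constants D" using Suc.prems by (simp add: constants_def)
  have "(D ^^ n) (f - ?c * y n) = 0"
    by (simp add: deriv_iter_diff deriv_iter_mult_constant[OF c] deriv_iter_chain[OF y])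
  from Suc.IH[OF this] obtain d where d: "\<forall>i. d i \<in> constants D"
    and f: "f - ?c * y n = (\<Sum>i<n. d i * y i)" by blast
  \<comment> \<open>Overwriting \<open>d\<close> at \<open>n\<close> does not disturb the sum over
    \<open>i < n\<close> and supplies the new top coefficient.\<close>
  from f have "f = (\<Sum>i<Suc n. (d(n := ?c)) i * y i)"
    by (simp add: algebra_simps)
  moreover have "\<forall>i. (d(n := ?c)) i \<in> constants D" using c d by simp
  ultimately show ?case by blast
qed

lemma chain_span:
  assumes y: "antiderivative_chain y"
  shows "family_span (constants D) y = nilpotents"
proof (intro subset_antisym subsetI)
  fix f assume "f \<in> family_span (constants D) y"
  then show "f \<in> nilpotents"
    using constants_subset_nilpotents
    by (induction rule: family_span_induct)
      (auto intro: zero_mem_nilpotents add_mem_nilpotents mult_mem_nilpotents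
        chain_mem_nilpotents[OF y])
next
  fix f assume "f \<in> nilpotents"
  then obtain n where "(D ^^ n) f = 0" by (auto simp: nilpotents_def)
  then obtain c where "\<forall>i. c i \<in> constants D" "f = (\<Sum>i<n. c i * y i)"
    using chain_expansion[OF y] by blast
  then show "f \<in> family_span (constants D) y" by (simp add: family_spanI)
qed

text \<open>Differentiating a relation removes the term of \<open>y 0 = 1\<close> and shifts the
  other coefficients down by one place. By induction these vanish, and the original relation then
  reduces to \<open>c 0 = 0\<close>.\<close>

lemma chain_independent:
  assumes y: "antiderivative_chain y"
  shows "family_independent (constants D) y"
proof -
  have *: "\<forall>i<n. c i = 0"
    if "\<forall>i. c i \<in> constants D" "(\<Sum>i<n. c i * y i) = 0" for n c
    using that
  proof (induction n arbitrary: c)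
    case (Suc n)
    have y0: "y 0 = 1" and ySuc: "\<And>n. D (y (Suc n)) = y n"
      using y by (auto simp: antiderivative_chain_def)
    have "D (\<Sum>i<Suc n. c i * y i) = (\<Sum>i<n. c (Suc i) * y i)"
      unfolding sum.lessThan_Suc_shift
      using Suc.prems(1) by (simp add: add sum deriv_mult_constant y0 ySuc deriv_constant)
    then have "(\<Sum>i<n. c (Suc i) * y i) = 0" by (simp only: Suc.prems(2) zero)
    then have tail: "\<forall>i<n. c (Suc i) = 0"
      using Suc.IH[of "\<lambda>i. c (Suc i)"] Suc.prems(1) by blast
    have "c 0 = 0" using Suc.prems(2) tail
      unfolding sum.lessThan_Suc_shift by (simp add: y0)
    with tail show ?case by (auto simp: less_Suc_eq_0_disj)
  qed simp
  show ?thesis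
    unfolding family_independent_def
  proof (intro allI impI, elim conjE)
    fix A c assume A: "finite A" and c: "\<forall>i\<in>A. c i \<in> constants D"
      and s: "(\<Sum>i\<in>A. c i * y i) = 0"
    \<comment> \<open>Extension by zero turns a relation over an arbitrary finite index set into one
      over an initial segment, where the induction above applies.\<close>
    define d where "d i = (if i \<in> A then c i else 0)" for i
    obtain n where n: "A \<subseteq> {..<n}"
      using A unfolding finite_nat_set_iff_bounded by auto
    have sum: "(\<Sum>i<n. d i * y i) = (\<Sum>i\<in>A. c i * y i)"
      by (rule sum.mono_neutral_cong_right) (use n in \<open>auto simp: d_def\<close>)
    have "\<forall>i. d i \<in> constants D" using c by (auto simp: d_def constants_def zero)
    then have "\<forall>i<n. d i = 0" by (rule *) (simp only: sum s)
    then show "\<forall>i\<in>A. c i = 0"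
      using n by (metis d_def lessThan_iff subsetD)
  qed
qed

text \<open>The factor \<open>Suc n\<close> from the power rule cancels against the factorial:
  \<open>1 / fact (Suc n)\<close> times \<open>Suc n\<close> is \<open>1 / fact n\<close>. The
  coefficients are constants, so \<open>D\<close> passes them.\<close>

lemma divided_powers_chain:
  assumes h: "rat_embedding h" and f: "D f = 1"
  shows "antiderivative_chain (\<lambda>n. h (1 / fact n) * f ^ n)"
proof -
  have "D (h (1 / fact (Suc n)) * f ^ Suc n) = h (1 / fact n) * f ^ n" for n
  proof -
    have c: "h (1 / fact (Suc n)) \<in> constants D"
      using rat_embedding_mem_constants[OF h, of "fact (Suc n)"] by (simp del: fact_Suc)
    have "h (1 / fact (Suc n)) * of_nat (Suc n) = h (1 / fact (Suc n) * of_nat (Suc n))"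
      by (simp only: rat_embedding_mult[OF h] rat_embedding_of_nat[OF h])
    also have "1 / fact (Suc n) * of_nat (Suc n) = (1 / fact n :: rat)"
      by (simp add: divide_simps)
    finally have "h (1 / fact (Suc n)) * of_nat (Suc n) = h (1 / fact n)" .
    moreover have "D (f ^ Suc n) = of_nat (Suc n) * f ^ n"
      using deriv_power_commuting[of f n] f by simp
    ultimately show ?thesis
      using deriv_mult_constant[OF c, of "f ^ Suc n"] by (simp only: mult.assoc[symmetric])
  qed
  moreover have "h 1 = 1" using h by (simp add: rat_embedding_def)
  ultimately show ?thesis by (simp add: antiderivative_chain_def)
qed

end

section \<open>Iterated integrals and the ring they span\<close>

context integro_differential_ring
begin

abbreviation C where "C \<equiv> constants D"
abbreviation E where "E \<equiv> evaluation D J"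
abbreviation x where "x \<equiv> iterated_integral J"

sublocale J: additive J
  using integral_linear by (simp add: bimodule_hom_def)

lemma integral_mult_constant: "c \<in> C \<Longrightarrow> J (c * f) = c * J f" "c \<in> C \<Longrightarrow> J (f * c) = J f * c"
  using integral_linear by (auto simp: bimodule_hom_def)

lemma iterated_integral_0 [simp]: "x 0 = 1"
  and iterated_integral_Suc: "x (Suc n) = J (x n)"
  by (simp_all add: iterated_integral_def)

lemma iterated_integral_chain: "antiderivative_chain x"
  by (simp add: antiderivative_chain_def iterated_integral_Suc deriv_integral)

lemma deriv_iterated_integral_Suc [simp]: "D (x (Suc n)) = x n"
  by (simp add: iterated_integral_Suc deriv_integral)

text \<open>Constants commute with 1, and \<open>J\<close> preserves this because it is linear on
  both sides.\<close>

lemma iterated_integral_commute: "c \<in> C \<Longrightarrow> x n * c = c * x n"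
proof (induction n)
  case (Suc n)
  then show ?case by (metis integral_mult_constant iterated_integral_Suc)
qed simp

lemma integral_polynomials_eq: "integral_polynomials D J = nilpotents"
  by (simp add: integral_polynomials_def chain_span iterated_integral_chain)

lemma integro_differential_subring_integral_polynomials:
  "integro_differential_subring D J (integral_polynomials D J)"
proof -
  \<comment> \<open>Since \<open>D (J f) = f\<close>, the element \<open>J f\<close> is an
    antiderivative of a member.\<close>
  have "J f \<in> nilpotents" if "f \<in> nilpotents" for f
    using that deriv_mem_nilpotents_iff[of "J f"] by (simp add: deriv_integral)
  then show ?thesis
    by (simp add: integro_differential_subring_def integral_polynomials_eq
        unital_subring_nilpotents deriv_mem_nilpotents_iff)
qed

text \<open>One inclusion holds because the span is a subring containing the generators. For the
  other, the span is rewritten with the divided powers of \<open>x 1\<close>, which visibly lie in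
  the generated subring.\<close>

lemma integral_polynomials_eq_subring_generated:
  fixes h :: "rat \<Rightarrow> 'a"
  assumes h: "rat_embedding h"
  shows "integral_polynomials D J = subring_generated (C \<union> {x 1})" (is "_ = ?S")
proof
  have "C \<union> {x 1} \<subseteq> nilpotents"
    using constants_subset_nilpotents chain_mem_nilpotents[OF iterated_integral_chain] by simp
  then show "?S \<subseteq> integral_polynomials D J"
    unfolding integral_polynomials_eq
    by (intro subring_generated_least unital_subring_nilpotents)
  note S = unital_subringD[OF unital_subring_generated[of "C \<union> {x 1}"]]
  have sub: "C \<subseteq> ?S" "x 1 \<in> ?S" using subring_generated_superset[of "C \<union> {x 1}"] by auto
  define y where "y = (\<lambda>n. h (1 / fact n) * x 1 ^ n)"
  have "antiderivative_chain y"
    unfolding y_def by (rule divided_powers_chain[OF h]) simp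
  \<comment> \<open>Both \<open>x\<close> and \<open>y\<close> are chains, so both spans equal
    \<open>nilpotents\<close>.\<close>
  then have "integral_polynomials D J = family_span C y"
    by (simp add: integral_polynomials_eq chain_span)
  moreover have "f \<in> ?S" if "f \<in> family_span C y" for f
    using that
  proof (induction rule: family_span_induct)
    case (scale c i)
    have "h (1 / fact i) \<in> C" using rat_embedding_mem_constants[OF h, of "fact i"] by simp
    with scale sub have "c \<in> ?S" "h (1 / fact i) \<in> ?S" by auto
    then show ?case unfolding y_def by (intro S sub(2))
  qed (intro S, assumption?)+
  ultimately show "integral_polynomials D J \<subseteq> ?S" by auto
qed

section \<open>The evaluation, its multiplicativity and the product formula\<close>

lemma evaluation_simps:
  "E 0 = 0" "E 1 = 1" "E (f + g) = E f + E g" "E (x (Suc n)) = 0"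
  by (simp_all add: evaluation_def zero add J.zero J.add iterated_integral_Suc deriv_integral)

lemma evaluation_mult_constant: "c \<in> C \<Longrightarrow> E (c * f) = c * E f"
  by (simp add: evaluation_def deriv_mult_constant integral_mult_constant algebra_simps)

text \<open>The value \<open>E (x n)\<close> is 1 for \<open>n = 0\<close> and 0 otherwise, hence
  central.\<close>

lemma evaluation_iterated_integral_commute: "E (x n) * c = c * E (x n)"
  by (cases n) (simp_all add: evaluation_simps)

text \<open>Since \<open>E\<close> kills \<open>x m\<close> for positive \<open>m\<close> and fixes
  1, the vanishing condition is multiplicativity on pairs of basis elements. It extends to the span
  by linearity, one factor at a time.\<close>

lemma multiplicative_on_integral_polynomials_iff:
  "multiplicative_on (integral_polynomials D J) E \<longleftrightarrow> (\<forall>m\<ge>1. \<forall>n\<ge>1. E (x m * x n) = 0)"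
proof
  assume mult: "multiplicative_on (integral_polynomials D J) E"
  have "E (x m * x n) = 0" if "m \<ge> 1" for m n
  proof -
    have "E (x m * x n) = E (x m) * E (x n)"
      using mult by (simp add: multiplicative_on_def integral_polynomials_eq
          chain_mem_nilpotents iterated_integral_chain)
    also have "E (x m) = 0" using that by (cases m) (simp_all add: evaluation_simps)
    finally show ?thesis by simp
  qed
  then show "\<forall>m\<ge>1. \<forall>n\<ge>1. E (x m * x n) = 0" by blast
next
  assume vanish: "\<forall>m\<ge>1. \<forall>n\<ge>1. E (x m * x n) = 0"
  have basis: "E (x m * x n) = E (x m) * E (x n)" for m n
    using vanish by (cases m; cases n) (simp_all add: evaluation_simps)
  have left: "E (x m * g) = E (x m) * E g" if "g \<in> family_span C x" for m g
    using that
  proof (induction rule: family_span_induct)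
    case (scale c i)
    \<comment> \<open>The scalar of the right factor must reach the far left before \<open>E\<close>
      can release it.\<close>
    have "x m * (c * x i) = c * (x m * x i)"
      using iterated_integral_commute[OF scale] by (simp flip: mult.assoc)
    then have "E (x m * (c * x i)) = c * (E (x m) * E (x i))"
      using scale by (simp add: evaluation_mult_constant basis)
    then show ?case
      using scale evaluation_iterated_integral_commute[of m c]
      by (simp add: evaluation_mult_constant flip: mult.assoc)
  qed (simp_all add: evaluation_simps distrib_left)
  have "E (f * g) = E f * E g" if "f \<in> family_span C x" "g \<in> family_span C x" for f g
    using that(1)
    by (induction rule: family_span_induct)
      (simp_all add: evaluation_simps distrib_right mult.assoc evaluation_mult_constant
        left[OF that(2)])
  then show "multiplicative_on (integral_polynomials D J) E"
    by (simp add: multiplicative_on_def integral_polynomials_def)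
qed

text \<open>Both Leibniz terms have index sum \<open>m + n - 1\<close>, so induction determines the
  derivative of the product; \<open>vanish\<close> then excludes a constant of integration.\<close>

lemma iterated_integral_mult:
  assumes vanish: "\<forall>m\<ge>1. \<forall>n\<ge>1. E (x m * x n) = 0"
  shows "x m * x n = of_nat ((m + n) choose m) * x (m + n)"
proof (induction "m + n" arbitrary: m n rule: less_induct)
  case less
  show ?case
  proof (cases "m = 0 \<or> n = 0")
    case False
    then obtain k l where kl: "m = Suc k" "n = Suc l"
      using not0_implies_Suc by blast
    have "D (x m * x n) = x k * x n + x m * x l"
      by (simp add: leibniz kl)
    \<comment> \<open>With \<open>k + n = m + l = Suc (k + l)\<close>, the two binomial coefficients
      add up by Pascal's rule.\<close>
    also have "\<dots> = of_nat ((m + n) choose m) * x (Suc (k + l))"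
      using less[of k n] less[of m l] by (simp add: kl distrib_right)
    finally have D: "D (x m * x n) = of_nat ((m + n) choose m) * x (Suc (k + l))" .
    have "x m * x n = J (D (x m * x n))"
      using vanish kl by (simp add: evaluation_def)
    also have "\<dots> = of_nat ((m + n) choose m) * J (x (Suc (k + l)))"
      unfolding D by (rule integral_mult_constant(1)[OF of_nat_mem_constants])
    finally show ?thesis by (simp add: kl iterated_integral_Suc)
  qed auto
qed

text \<open>Iterates the product formula with second index 1, where the binomial coefficient is
  \<open>Suc n\<close>. With the denominators cleared, the identity makes sense in every
  characteristic.\<close>

lemma iterated_integral_one_power:
  assumes "\<forall>m\<ge>1. \<forall>n\<ge>1. E (x m * x n) = 0"
  shows "x 1 ^ n = of_nat (fact n) * x n"
proof (induction n)
  case (Suc n)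
  have "x 1 ^ Suc n = of_nat (fact n) * (x n * x 1)"
    unfolding power_Suc2 Suc by (rule mult.assoc)
  also have "\<dots> = of_nat (fact n) * (of_nat (Suc n) * x (Suc n))"
    using iterated_integral_mult[OF assms, of n 1] by simp
  also have "\<dots> = of_nat (fact n * Suc n) * x (Suc n)"
    by (simp only: of_nat_mult mult.assoc)
  also have "fact n * Suc n = fact (Suc n)" by simp
  finally show ?case .
qed simp

lemma iterated_integral_eq_divided_power:
  assumes "\<forall>m\<ge>1. \<forall>n\<ge>1. E (x m * x n) = 0" "rat_embedding h"
  shows "x n = h (1 / fact n) * x 1 ^ n"
proof -
  have "h (1 / fact n) * of_nat (fact n) = 1"
    using rat_embedding_inverse[OF assms(2), of "fact n"] by simp
  then show ?thesis
    unfolding iterated_integral_one_power[OF assms(1)] by (simp flip: mult.assoc del: of_nat_fact)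
qed

end

theorem theorem3p2:
  fixes D J :: "'a::ring_1 \<Rightarrow> 'a"
    and C P :: "'a set" and E :: "'a \<Rightarrow> 'a" and x :: "nat \<Rightarrow> 'a"
  assumes "integro_differential_ring D J"
    and "C = constants D"
    and "E = evaluation D J"
    and "x = iterated_integral J"
    and "P = integral_polynomials D J"
  shows "(\<forall>n. \<forall>c\<in>C. x n * c = c * x n)
    \<and> family_independent C x
    \<and> integro_differential_subring D J P
    \<and> ((\<exists>h :: rat \<Rightarrow> 'a. rat_embedding h) \<longrightarrow> P = subring_generated (C \<union> {x 1}))
    \<and> (multiplicative_on P E \<longleftrightarrow> (\<forall>m\<ge>1. \<forall>n\<ge>1. E (x m * x n) = 0))
    \<and> (multiplicative_on P E \<longrightarrow>
        (\<forall>m n. x m * x n = of_nat ((m + n) choose m) * x (m + n))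
        \<and> (\<forall>h :: rat \<Rightarrow> 'a. rat_embedding h \<longrightarrow> (\<forall>n. x n = h (1 / fact n) * x 1 ^ n)))"
proof -
  interpret integro_differential_ring D J by (fact assms(1))
  show ?thesis
    unfolding assms(2-5)
    \<comment> \<open>The product and power formulas are proved from the vanishing of
      \<open>E (x m * x n)\<close>; the equivalence turns multiplicativity into that
      condition.\<close>
    using iterated_integral_commute chain_independent[OF iterated_integral_chain]
      integro_differential_subring_integral_polynomials integral_polynomials_eq_subring_generated
      multiplicative_on_integral_polynomials_iff iterated_integral_mult
      iterated_integral_eq_divided_power
    by blast
qed

end
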